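(* Let $a$ and $b$ be coprime odd integers and let $\beta\ge 1$ be an integer. Then the following are equivalent: (1) $2^{\beta}\mid a+b$; (2) $2^{\beta}\in G_{(a,b)}$; (3) $\beta=1$ or $ab^{-1}\equiv -1 \pmod{2^{\beta}}$.
   Context: For coprime nonzero integers $a,b$, a positive integer $\ell$ is called good (with respect to $a$ and $b$) if there exists a positive integer $k$ such that $\ell\mid a^k+b^k$; $G_{(a,b)}$ denotes the set of all good integers with respect to $a$ and $b$. Here $b^{-1}$ denotes the multiplicative inverse of $b$ modulo $2^{\beta}$. *)

theory Defs
  imports "HOL-Number_Theory.Number_Theory" "HOL-Number_Theory.Modular_Inverse"
begin

(* Meant for coprime nonzero a and b. For particular k the sum a ^ k + b ^ k may be zero
   or negative, so divisibility is taken in the integers. *)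
definition good :: "int \<Rightarrow> int \<Rightarrow> int \<Rightarrow> bool" where
  "good a b l \<longleftrightarrow> l > 0 \<and> (\<exists>k::nat. k > 0 \<and> l dvd a ^ k + b ^ k)"

definition good_integers :: "int \<Rightarrow> int \<Rightarrow> int set" where
  "good_integers a b = {l. good a b l}"

end

theory Submission
  imports Defs
begin

text \<open>
  The parity of the exponent decides everything. For even \<open>k\<close> both powers are odd squares,
  so \<open>a ^ k + b ^ k \<equiv> 2\<close> modulo 4 and only \<open>\<beta> = 1\<close> can occur; then \<open>2\<close> divides \<open>a + b\<close> by parity.
  For odd \<open>k\<close> the sum factors as \<open>(a + b) * s\<close>, and the cofactor \<open>s\<close> is a sum of \<open>k\<close> odd
  terms, hence odd, so it takes away no power of two: \<open>2 ^ \<beta>\<close> already divides \<open>a + b\<close>.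
  Therefore goodness can always be tested at exponent \<open>k = 1\<close>. Multiplying by the unit \<open>b\<close>
  modulo \<open>2 ^ \<beta>\<close> turns \<open>a + b \<equiv> 0\<close> into the condition on \<open>a\<close> times the inverse of \<open>b\<close>.
\<close>

lemma odd_power_sum_factor:
  fixes a b :: int
  assumes "odd a" and "odd b"
  shows "\<exists>s. odd s \<and> a ^ (2 * m + 1) + b ^ (2 * m + 1) = (a + b) * s"
proof (induction m)
  case 0
  show ?case by (intro exI[of _ 1]) simp
next
  case (Suc m)
  then obtain s where s: "odd s"
    and eq: "a ^ (2 * m + 1) + b ^ (2 * m + 1) = (a + b) * s" by blast
  let ?B = "b ^ (2 * m + 1)"
  \<comment> \<open>Replacing \<open>b\<^sup>2\<close> by \<open>a\<^sup>2\<close> costs \<open>b\<^sup>2 - a\<^sup>2\<close>, which is \<open>a + b\<close> times an even number, so the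
    new cofactor keeps the parity of the old one.\<close>
  have "a ^ (2 * Suc m + 1) + b ^ (2 * Suc m + 1)
      = a\<^sup>2 * (a ^ (2 * m + 1) + ?B) + ?B * (b\<^sup>2 - a\<^sup>2)"
    by (simp add: algebra_simps power2_eq_square)
  also have "\<dots> = (a + b) * (a\<^sup>2 * s + ?B * (b - a))"
    unfolding eq by (simp add: algebra_simps power2_eq_square)
  finally have "a ^ (2 * Suc m + 1) + b ^ (2 * Suc m + 1)
      = (a + b) * (a\<^sup>2 * s + ?B * (b - a))" .
  moreover have "odd (a\<^sup>2 * s + ?B * (b - a))"
    using assms s by simp
  ultimately show ?case by blast
qed

text \<open>An odd square is 1 modulo 4, so a sum of two of them is 2 modulo 4.\<close>

lemma not_four_dvd_even_power_sum:
  fixes a b :: int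
  assumes "odd a" and "odd b" and "even k"
  shows "\<not> 4 dvd a ^ k + b ^ k"
proof -
  have square: "[x ^ k = 1] (mod 4)" if "odd x" for x :: int
  proof -
    from \<open>even k\<close> obtain m where k: "k = 2 * m" by (elim evenE)
    from that obtain y where "x = 2 * y + 1" by (elim oddE)
    then have "x\<^sup>2 - 1 = 4 * (y\<^sup>2 + y)"
      by (simp add: power2_eq_square algebra_simps)
    then have "[x\<^sup>2 = 1] (mod 4)"
      by (simp add: cong_iff_dvd_diff)
    then have "[(x\<^sup>2) ^ m = 1 ^ m] (mod 4)"
      by (rule cong_pow)
    then show ?thesis by (simp add: k power_mult)
  qed
  have "[a ^ k + b ^ k = 1 + 1] (mod 4)"
    using assms(1,2) by (intro cong_add square)
  then show ?thesis
    by (simp add: cong_dvd_iff)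
qed

lemma two_power_dvd_power_sum_imp_dvd_sum:
  fixes a b :: int
  assumes "odd a" and "odd b" and dvd: "2 ^ n dvd a ^ k + b ^ k"
  shows "2 ^ n dvd a + b"
proof (cases "even k")
  case True
  have "n < 2"
  proof (rule ccontr)
    assume "\<not> n < 2"
    then have "(2::int) ^ 2 dvd 2 ^ n" by (intro le_imp_power_dvd) simp
    then have "4 dvd a ^ k + b ^ k" using dvd dvd_trans by fastforce
    with not_four_dvd_even_power_sum[OF assms(1,2) True] show False ..
  qed
  then have "n = 0 \<or> n = 1" by auto
  with assms(1,2) show ?thesis by auto
next
  case False
  then obtain m where "k = 2 * m + 1" by (elim oddE)
  with odd_power_sum_factor[OF assms(1,2), of m]
  obtain s where s: "odd s" "a ^ k + b ^ k = (a + b) * s" by blast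
  from s(1) have "coprime (2 ^ n) s" by simp
  with dvd s(2) show ?thesis by (simp add: coprime_dvd_mult_left_iff)
qed

lemma dvd_add_iff_cong_modular_inverse:
  fixes a b m :: int
  assumes "coprime b m"
  shows "m dvd a + b \<longleftrightarrow> [a * modular_inverse m b = - 1] (mod m)"
proof -
  have inv: "[b * modular_inverse m b = 1] (mod m)"
    using assms by (rule cong_modular_inverse1)
  have "m dvd a + b \<longleftrightarrow> [a = - 1 * b] (mod m)"
    by (simp add: cong_iff_dvd_diff)
  also have "\<dots> \<longleftrightarrow> [a * modular_inverse m b * b = - 1 * b] (mod m)"
  proof -
    have "[a * (b * modular_inverse m b) = a * 1] (mod m)"
      using inv by (intro cong_mult cong_refl)
    then have "[a * modular_inverse m b * b = a] (mod m)"
      by (simp add: ac_simps)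
    then show ?thesis by (meson cong_sym cong_trans)
  qed
  also have "\<dots> \<longleftrightarrow> [a * modular_inverse m b = - 1] (mod m)"
    using assms by (rule cong_mult_rcancel)
  finally show ?thesis .
qed

theorem proposition1:
  fixes a b :: int and \<beta> :: nat
  assumes "coprime a b" and "odd a" and "odd b" and "\<beta> \<ge> 1"
  shows "(2 ^ \<beta> dvd a + b \<longleftrightarrow> 2 ^ \<beta> \<in> good_integers a b) \<and>
         (2 ^ \<beta> \<in> good_integers a b \<longleftrightarrow>
            \<beta> = 1 \<or> [a * modular_inverse (2 ^ \<beta>) b = - 1] (mod 2 ^ \<beta>))"
proof -
  have good_iff: "2 ^ \<beta> \<in> good_integers a b \<longleftrightarrow> 2 ^ \<beta> dvd a + b"
  proof
    assume "2 ^ \<beta> \<in> good_integers a b"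
    then obtain k where "2 ^ \<beta> dvd a ^ k + b ^ k"
      by (auto simp: good_integers_def good_def)
    with assms(2,3) show "2 ^ \<beta> dvd a + b"
      by (rule two_power_dvd_power_sum_imp_dvd_sum)
  next
    assume "2 ^ \<beta> dvd a + b"
    then show "2 ^ \<beta> \<in> good_integers a b"
      by (auto simp: good_integers_def good_def intro!: exI[of _ 1])
  qed
  have "coprime b (2 ^ \<beta>)"
    using assms(3) by simp
  then have "2 ^ \<beta> dvd a + b \<longleftrightarrow> [a * modular_inverse (2 ^ \<beta>) b = - 1] (mod 2 ^ \<beta>)"
    by (rule dvd_add_iff_cong_modular_inverse)
  moreover have "2 ^ \<beta> dvd a + b" if "\<beta> = 1"
    using that assms(2,3) by simp
  ultimately show ?thesis
    using good_iff by blast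
qed

end
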